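(* Let $\varepsilon>0$ and $\rho\in(0,1)$. Let $(x_k)_{k\ge0}$ be generated by algorithm CPG or CGD (see context) under the assumptions stated there, with $i_k$ chosen uniformly at random, and assume that for some constant $C>0$, $$F(x_k)-\mathbb{E}[F(x_{k+1})\mid x_k]\ge C\|\nabla F(x_k)\|^2\qquad\forall k\ge0 .$$ If $k\ge1$ is an integer with $$k\ge\frac{F(x_0)-F^*}{\varepsilon\rho C},$$ then $$\mathbb{P}\Big[\min_{0\le i\le k-1}\|\nabla F(x_i)\|^2\le\varepsilon\Big]\ge1-\rho .$$
   Context: Setting: $F=f+\psi$ with $f,\psi:\mathbb{R}^n\to\mathbb{R}$, $f$ differentiable, both possibly nonconvex; $F^*=\min F$. $U=[U_1,\dots,U_N]\in\mathbb{R}^{n\times n}$ is a column permutation of $I_n$, split into $U_i\in\mathbb{R}^{n\times n_i}$, $\sum_i n_i=n$. Norms are Euclidean / induced operator norms. The $i_k$ are independent, each uniform on $\{1,\dots,N\}$ and independent of the past; $x_0$ is deterministic. Assumptions. A.1: $\|U_i^T(\nabla f(x+U_ih)-\nabla f(x))\|\le L_i\|h\|$ for all $h,x,i$. A.2: $\psi$ is twice continuously differentiable. A.3: $F$ attains its minimum $F^*>-\infty$. Algorithm CPG: fix $\eta_i>0$; $H_{f,U_i}=\frac{L_i+\eta_i}{2}$ if $d\mapsto\psi(x+U_id)$ is convex for all $x,i$, else $H_{f,U_i}=L_i+\eta_i$. Given $x_0$, for $k\ge0$: choose $i_k$; take $d_k\in\arg\min_{d\in\mathbb{R}^{n_{i_k}}}f(x_k)+\langle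 U_{i_k}^T\nabla f(x_k),d\rangle+\frac{H_{f,U_{i_k}}}{2}\|d\|^2+\psi(x_k+U_{i_k}d)$ (assumed to exist); $x_{k+1}=x_k+U_{i_k}d_k$. Algorithm CGD: fix $\eta_i>0$; $H_{f,U_i}=\frac{L_i+\eta_i}{2}$. Given $x_0$, for $k\ge0$: choose $i_k$, compute $H_{F_k}$ by one of the rules below, $d_k=-\frac1{H_{F_k}}U_{i_k}^T\nabla F(x_k)$, $x_{k+1}=x_k+U_{i_k}d_k$. The same rule is used for all $k$, and $\psi$ satisfies the assumption attached to it: Rule 1 (A.4 and A.5): $\alpha_k\ge0$ root of $\frac{L_\psi}{6}\alpha^2+(\frac{H_\psi}{2}\|x_k\|^p+H_{f,U_{i_k}})\alpha=\|U_{i_k}^T\nabla F(x_k)\|$; $H_{F_k}=\frac{H_\psi}{2}\|x_k\|^p+\frac{L_\psi}{6}\alpha_k+H_{f,U_{i_k}}$. Rule 2 (A.4): $\alpha_k\ge0$ root of $2^{p-1}H_\psi\alpha^{p+1}+(2^{p-1}H_\psi\|x_k\|^p+H_{f,U_{i_k}})\alpha=\|U_{i_k}^T\nabla F(x_k)\|$; $H_{F_k}=2^{p-1}H_\psi\|x_k\|^p+2^{p-1}H_\psi\alpha_k^p+H_{f,U_{i_k}}$. Rule 3 (A.5): $\alpha_k\ge0$ root of $\frac{L_\psi}{6}\alpha^2+(\frac{L_\psi}{2}\|x_k-x_0\|+\frac12\|\nabla^2\psi(x_0)\|+H_{f,U_{i_k}})\alpha=\|U_{i_k}^T\nabla F(x_k)\|$;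 $H_{F_k}=\frac{L_\psi}{2}\|x_k-x_0\|+\frac12\|\nabla^2\psi(x_0)\|+\frac{L_\psi}{6}\alpha_k+H_{f,U_{i_k}}$. Rule 4 (A.6): $H_{F_k}=H_{f,U_{i_k}}$. Here A.4: $\|U_i^T\nabla^2\psi(y)U_i\|\le H_\psi\|y\|^p$ for all $y,i$ ($H_\psi>0$, integer $p\ge1$); A.5: $\|\nabla^2\psi(y)-\nabla^2\psi(x)\|\le L_\psi\|y-x\|$ for all $x,y$ ($L_\psi>0$); A.6: $\psi(x+U_id)\le\psi(x)+\langle U_i^T\nabla\psi(x),d\rangle$ for all $x,d,i$. *)

theory Defs
  imports "HOL-Probability.Probability"
begin

definition grad :: "(real^'n \<Rightarrow> real) \<Rightarrow> real^'n \<Rightarrow> real^'n" where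
  "grad f x = (THE g. GDERIV f x :> g)"

definition hessian :: "(real^'n \<Rightarrow> real) \<Rightarrow> real^'n \<Rightarrow> real^'n^'n" where
  "hessian f x = jacobian (grad f) (at x)"

definition twice_cont_diff :: "(real^'n \<Rightarrow> real) \<Rightarrow> bool" where
  "twice_cont_diff f \<longleftrightarrow>
     (\<forall>x. f differentiable (at x)) \<and> (\<forall>x. grad f differentiable (at x)) \<and>
     continuous_on UNIV (hessian f)"

(* The block dimensions vary with the block, so a vector of R^m is a sequence of reals that
   vanishes from index m on (coordinates 0,...,m-1), and an n x m matrix is the list of its
   m columns; in particular m is the length of that list. *)

definition Rvec :: "nat \<Rightarrow> (nat \<Rightarrow> real) set" where
  "Rvec m = {d. \<forall>j\<ge>m. d j = 0}"

definition rnorm :: "nat \<Rightarrow> (nat \<Rightarrow> real) \<Rightarrow> real" where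
  "rnorm m d = L2_set d {..<m}"

definition rinner :: "nat \<Rightarrow> (nat \<Rightarrow> real) \<Rightarrow> (nat \<Rightarrow> real) \<Rightarrow> real" where
  "rinner m c d = (\<Sum>j<m. c j * d j)"

definition block_mult :: "(real^'n) list \<Rightarrow> (nat \<Rightarrow> real) \<Rightarrow> real^'n" where
  "block_mult V d = (\<Sum>j<length V. d j *\<^sub>R (V ! j))"

definition block_tmult :: "(real^'n) list \<Rightarrow> real^'n \<Rightarrow> nat \<Rightarrow> real" where
  "block_tmult V v = (\<lambda>j. if j < length V then (V ! j) \<bullet> v else 0)"

(* Induced operator norm of V^T A V as a map of R^m to itself, written as in the
   definition of onorm (the quotient is 0 at d = 0). *)
definition block_onorm :: "(real^'n) list \<Rightarrow> real^'n^'n \<Rightarrow> real" where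
  "block_onorm V A =
     (SUP d\<in>Rvec (length V).
        rnorm (length V) (block_tmult V (A *v block_mult V d)) / rnorm (length V) d)"

(* U = [U_1,...,U_N] with N = length U and U_i = U ! (i - 1): the concatenated columns are the
   columns of the identity matrix, each occurring exactly once. *)
definition column_permutation :: "(real^'n) list list \<Rightarrow> bool" where
  "column_permutation U \<longleftrightarrow>
     distinct (concat U) \<and> set (concat U) = columns (mat 1 :: real^'n^'n)"

definition block_Lipschitz ::
  "(real^'n) list list \<Rightarrow> (nat \<Rightarrow> real) \<Rightarrow> (real^'n \<Rightarrow> real) \<Rightarrow> bool" where
  "block_Lipschitz U L f \<longleftrightarrow>
     (\<forall>i<length U. \<forall>x. \<forall>h\<in>Rvec (length (U ! i)).
        rnorm (length (U ! i)) (block_tmult (U ! i) (grad f (x + block_mult (U ! i) h) - grad f x))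
          \<le> L i * rnorm (length (U ! i)) h)"

definition hessian_growth ::
  "(real^'n) list list \<Rightarrow> real \<Rightarrow> nat \<Rightarrow> (real^'n \<Rightarrow> real) \<Rightarrow> bool" where
  "hessian_growth U H p \<psi> \<longleftrightarrow>
     0 < H \<and> 1 \<le> p \<and>
     (\<forall>i<length U. \<forall>y. block_onorm (U ! i) (hessian \<psi> y) \<le> H * norm y ^ p)"

definition hessian_Lipschitz :: "real \<Rightarrow> (real^'n \<Rightarrow> real) \<Rightarrow> bool" where
  "hessian_Lipschitz L \<psi> \<longleftrightarrow>
     0 < L \<and> (\<forall>x y. onorm ((*v) (hessian \<psi> y - hessian \<psi> x)) \<le> L * norm (y - x))"

definition block_linear_upper_bound ::
  "(real^'n) list list \<Rightarrow> (real^'n \<Rightarrow> real) \<Rightarrow> bool" where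
  "block_linear_upper_bound U \<psi> \<longleftrightarrow>
     (\<forall>i<length U. \<forall>x. \<forall>d\<in>Rvec (length (U ! i)).
        \<psi> (x + block_mult (U ! i) d) \<le> \<psi> x + rinner (length (U ! i)) (block_tmult (U ! i) (grad \<psi> x)) d)"

(* The inner condition is convex_on unfolded: nat => real is not a real_vector instance. *)
definition blockwise_convex :: "(real^'n) list list \<Rightarrow> (real^'n \<Rightarrow> real) \<Rightarrow> bool" where
  "blockwise_convex U \<psi> \<longleftrightarrow>
     (\<forall>i<length U. \<forall>x. \<forall>d\<in>Rvec (length (U ! i)). \<forall>e\<in>Rvec (length (U ! i)).
        \<forall>u\<ge>0. \<forall>v\<ge>0. u + v = 1 \<longrightarrow>
          \<psi> (x + block_mult (U ! i) (\<lambda>j. u * d j + v * e j))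
            \<le> u * \<psi> (x + block_mult (U ! i) d) + v * \<psi> (x + block_mult (U ! i) e))"

definition cpg_step ::
  "(real^'n \<Rightarrow> real) \<Rightarrow> (real^'n \<Rightarrow> real) \<Rightarrow> (real^'n) list list \<Rightarrow> (nat \<Rightarrow> real) \<Rightarrow> (nat \<Rightarrow> real) \<Rightarrow>
   nat \<Rightarrow> real^'n \<Rightarrow> real^'n \<Rightarrow> bool" where
  "cpg_step f \<psi> U L \<eta> i x x' \<longleftrightarrow>
     (let V = U ! i; m = length V;
          H = (if blockwise_convex U \<psi> then (L i + \<eta> i) / 2 else L i + \<eta> i)
      in \<exists>d. is_arg_min
               (\<lambda>d. f x + rinner m (block_tmult V (grad f x)) d + H / 2 * (rnorm m d)\<^sup>2
                    + \<psi> (x + block_mult V d))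
               (\<lambda>d. d \<in> Rvec m) d
             \<and> x' = x + block_mult V d)"

(* Rules for H_F at the current point x, as relations: Hf stands for H_{f,U_i} and g for the
   norm of U_i^T grad F(x). *)

definition rule1 :: "real \<Rightarrow> real \<Rightarrow> nat \<Rightarrow> real \<Rightarrow> real \<Rightarrow> real^'n \<Rightarrow> real \<Rightarrow> bool" where
  "rule1 H\<psi> L\<psi> p Hf g x HF \<longleftrightarrow>
     (\<exists>\<alpha>\<ge>0. L\<psi> / 6 * \<alpha>\<^sup>2 + (H\<psi> / 2 * norm x ^ p + Hf) * \<alpha> = g \<and>
             HF = H\<psi> / 2 * norm x ^ p + L\<psi> / 6 * \<alpha> + Hf)"

definition rule2 :: "real \<Rightarrow> nat \<Rightarrow> real \<Rightarrow> real \<Rightarrow> real^'n \<Rightarrow> real \<Rightarrow> bool" where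
  "rule2 H\<psi> p Hf g x HF \<longleftrightarrow>
     (\<exists>\<alpha>\<ge>0. 2 ^ (p - 1) * H\<psi> * \<alpha> ^ (p + 1) + (2 ^ (p - 1) * H\<psi> * norm x ^ p + Hf) * \<alpha> = g \<and>
             HF = 2 ^ (p - 1) * H\<psi> * norm x ^ p + 2 ^ (p - 1) * H\<psi> * \<alpha> ^ p + Hf)"

definition rule3 ::
  "(real^'n \<Rightarrow> real) \<Rightarrow> real \<Rightarrow> real^'n \<Rightarrow> real \<Rightarrow> real \<Rightarrow> real^'n \<Rightarrow> real \<Rightarrow> bool" where
  "rule3 \<psi> L\<psi> x0 Hf g x HF \<longleftrightarrow>
     (\<exists>\<alpha>\<ge>0. L\<psi> / 6 * \<alpha>\<^sup>2
               + (L\<psi> / 2 * norm (x - x0) + 1 / 2 * onorm ((*v) (hessian \<psi> x0)) + Hf) * \<alpha> = g \<and>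
             HF = L\<psi> / 2 * norm (x - x0) + 1 / 2 * onorm ((*v) (hessian \<psi> x0))
                    + L\<psi> / 6 * \<alpha> + Hf)"

definition rule4 :: "real \<Rightarrow> real \<Rightarrow> real^'n \<Rightarrow> real \<Rightarrow> bool" where
  "rule4 Hf g x HF \<longleftrightarrow> HF = Hf"

definition cgd_step ::
  "(real \<Rightarrow> real \<Rightarrow> real^'n \<Rightarrow> real \<Rightarrow> bool) \<Rightarrow>
   (real^'n \<Rightarrow> real) \<Rightarrow> (real^'n) list list \<Rightarrow> (nat \<Rightarrow> real) \<Rightarrow> (nat \<Rightarrow> real) \<Rightarrow>
   nat \<Rightarrow> real^'n \<Rightarrow> real^'n \<Rightarrow> bool" where
  "cgd_step R F U L \<eta> i x x' \<longleftrightarrow>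
     (let V = U ! i; G = block_tmult V (grad F x)
      in \<exists>HF. R ((L i + \<eta> i) / 2) (rnorm (length V) G) x HF \<and>
              x' = x + block_mult V (\<lambda>j. - (1 / HF) * G j))"

(* Sigma-algebra generated by x_0,...,x_k and i_0,...,i_(k-1), with block indices below N. *)
definition past ::
  "'w measure \<Rightarrow> nat \<Rightarrow> (nat \<Rightarrow> 'w \<Rightarrow> nat) \<Rightarrow> (nat \<Rightarrow> 'w \<Rightarrow> real^'n) \<Rightarrow> nat \<Rightarrow> 'w measure" where
  "past M N idx X k =
     vimage_algebra (space M)
       (\<lambda>\<omega>. (\<lambda>j\<in>{..k}. X j \<omega>, \<lambda>j\<in>{..<k}. idx j \<omega>))
       ((\<Pi>\<^sub>M j\<in>{..k}. borel) \<Otimes>\<^sub>M (\<Pi>\<^sub>M j\<in>{..<k}. count_space {..<N}))"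

definition uniform_block_choice ::
  "'w measure \<Rightarrow> nat \<Rightarrow> (nat \<Rightarrow> 'w \<Rightarrow> nat) \<Rightarrow> (nat \<Rightarrow> 'w \<Rightarrow> real^'n) \<Rightarrow> bool" where
  "uniform_block_choice M N idx X \<longleftrightarrow>
     prob_space.indep_vars M (\<lambda>_. count_space {..<N}) idx UNIV \<and>
     (\<forall>k. distr M (count_space {..<N}) (idx k) = uniform_count_measure {..<N}) \<and>
     (\<forall>k. prob_space.indep_set M
            (sets (vimage_algebra (space M) (idx k) (count_space {..<N})))
            (sets (past M N idx X k)))"

end

theory Submission
  imports Defs
begin

text \<open>
  If $F(x_j)$ is integrable, taking expectations in the descent inequality and telescoping gives
  $C \sum_{j<k} E\,\|\nabla F(x_j)\|^2 \le F(x_0) - F^*$; the minimum of the squared gradient norms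
  is at most their average, so Markov's inequality yields the claim. Integrability needs the
  algorithm: a CPG step never increases $F$, and in CGD the step is a function of the iterate and
  the block index (the equation for $\alpha_k$ has at most one nonnegative root), so each $x_j$
  takes only finitely many values.
\<close>

section \<open>Blocks in coordinates: homogeneity, adjointness and Cauchy-Schwarz\<close>

lemma block_mult_scale: "block_mult V (\<lambda>j. c * d j) = c *\<^sub>R block_mult V d"
  by (simp add: block_mult_def scaleR_sum_right)

lemma inner_block_mult: "v \<bullet> block_mult V d = rinner (length V) (block_tmult V v) d"
  by (auto simp: block_mult_def rinner_def block_tmult_def inner_sum_right inner_commute
      intro!: sum.cong)

lemma rinner_scale: "rinner m c (\<lambda>j. t * d j) = t * rinner m c d"
  by (simp add: rinner_def sum_distrib_left algebra_simps)

lemma rnorm_nonneg: "0 \<le> rnorm m d"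
  by (simp add: rnorm_def)

lemma rnorm_scale: "0 \<le> t \<Longrightarrow> rnorm m (\<lambda>j. t * d j) = t * rnorm m d"
  by (simp add: rnorm_def L2_set_right_distrib)

lemma rinner_le_rnorm: "rinner m c d \<le> rnorm m c * rnorm m d"
proof -
  have "rinner m c d \<le> (\<Sum>j<m. \<bar>c j\<bar> * \<bar>d j\<bar>)"
    unfolding rinner_def by (intro sum_mono) (metis abs_ge_self abs_mult)
  also have "\<dots> \<le> rnorm m c * rnorm m d"
    unfolding rnorm_def by (rule L2_set_mult_ineq)
  finally show ?thesis .
qed

section \<open>Gradients: representation of the derivative, restriction to lines,
  measurability\<close>

text \<open>Since \<open>grad\<close> is a definite description, it carries information only once
  the representing vector exists and is unique. Expanding \<open>h\<close> in the orthonormal basis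
  gives the vector with coordinates \<open>D b\<close>; uniqueness follows from uniqueness of the
  derivative.\<close>

lemma has_derivative_grad:
  assumes "f differentiable (at x)"
  shows "(f has_derivative (\<lambda>h. h \<bullet> grad f x)) (at x)"
proof -
  obtain D where D: "(f has_derivative D) (at x)"
    using assms by (auto simp: differentiable_def)
  interpret linear D
    using D by (rule has_derivative_linear)
  have "D h = h \<bullet> (\<Sum>b\<in>Basis. D b *\<^sub>R b)" for h
  proof -
    have "D h = D (\<Sum>b\<in>Basis. (h \<bullet> b) *\<^sub>R b)"
      by (simp add: euclidean_representation)
    then show ?thesis
      by (simp add: sum scale inner_sum_right mult.commute)
  qed
  then have "D = (\<lambda>h. h \<bullet> (\<Sum>b\<in>Basis. D b *\<^sub>R b))"
    by (rule ext)
  with D have ex: "GDERIV f x :> (\<Sum>b\<in>Basis. D b *\<^sub>R b)"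
    unfolding gderiv_def by metis
  have "\<exists>!g. GDERIV f x :> g"
  proof (rule ex1I, rule ex)
    fix g assume "GDERIV f x :> g"
    then have "(\<lambda>h. h \<bullet> g) = (\<lambda>h. h \<bullet> (\<Sum>b\<in>Basis. D b *\<^sub>R b))"
      using ex unfolding gderiv_def by (rule has_derivative_unique)
    then show "g = (\<Sum>b\<in>Basis. D b *\<^sub>R b)"
      using vector_eq_ldot by (metis (no_types))
  qed
  from theI'[OF this] show ?thesis
    by (simp add: grad_def gderiv_def)
qed

lemma DERIV_along_line:
  assumes "\<And>x. f differentiable (at x)"
  shows "((\<lambda>t. f (x + t *\<^sub>R v)) has_real_derivative grad f (x + t *\<^sub>R v) \<bullet> v) (at t)"
proof -
  have "((\<lambda>t. x + t *\<^sub>R v) has_derivative (\<lambda>t. t *\<^sub>R v)) (at t)"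
    by (auto intro!: derivative_eq_intros)
  from has_derivative_compose[OF this has_derivative_grad[OF assms]]
  show ?thesis
    by (simp add: has_field_derivative_def inner_commute[of v] mult_commute_abs)
qed

text \<open>Each component of the gradient is a pointwise limit of difference quotients with
  increments 1/(n+1), and these are continuous because differentiability makes \<open>f\<close>
  continuous. No continuity of the gradient enters.\<close>

lemma grad_measurable:
  fixes f :: "real^'n \<Rightarrow> real"
  assumes diff: "\<And>x. f differentiable (at x)"
  shows "grad f \<in> borel_measurable borel"
proof (subst borel_measurable_euclidean_space, intro ballI)
  fix b :: "real^'n"
  have cont: "continuous_on UNIV f"
    by (intro differentiable_imp_continuous_on) (simp add: differentiable_on_def diff)
  then have [measurable]: "f \<in> borel_measurable borel"
    by (rule borel_measurable_continuous_onI)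
  have lim: "filterlim (\<lambda>n. 1 / real (Suc n)) (at 0) sequentially"
    using LIMSEQ_inverse_real_of_nat by (simp add: filterlim_at inverse_eq_divide)
  show "(\<lambda>x. grad f x \<bullet> b) \<in> borel_measurable borel"
  proof (rule borel_measurable_LIMSEQ_real)
    fix x :: "real^'n"
    have "((\<lambda>t. (f (x + t *\<^sub>R b) - f x) / t) \<longlongrightarrow> grad f x \<bullet> b) (at 0)"
      using DERIV_along_line[OF diff, of x b 0] by (simp add: has_field_derivative_iff)
    from filterlim_compose[OF this lim]
    show "(\<lambda>n. (f (x + (1 / real (Suc n)) *\<^sub>R b) - f x) / (1 / real (Suc n)))
            \<longlonglongrightarrow> grad f x \<bullet> b" .
  qed measurable
qed

section \<open>Monotonicity of F along a CPG step\<close>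

lemma block_descent_lemma:
  assumes diff: "\<And>x. f differentiable (at x)"
    and lip: "block_Lipschitz U L f" and i: "i < length U" and d: "d \<in> Rvec (length (U ! i))"
  shows "f (x + block_mult (U ! i) d)
           \<le> f x + rinner (length (U ! i)) (block_tmult (U ! i) (grad f x)) d
               + L i / 2 * (rnorm (length (U ! i)) d)\<^sup>2"
proof -
  define V where "V = U ! i"
  define m where "m = length V"
  define v where "v = block_mult V d"
  \<comment> \<open>\<open>q\<close> is f along the segment minus the linear and quadratic terms of
    the claimed bound. It starts at \<open>f x\<close>, so the claim is
    \<open>q 1 \<le> q 0\<close>, which follows from a nonpositive derivative without any
    integration.\<close>
  define q where "q t = f (x + t *\<^sub>R v) - t * (grad f x \<bullet> v) - L i / 2 * t\<^sup>2 * (rnorm m d)\<^sup>2" for t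
  have "q 1 \<le> q 0"
  proof (rule DERIV_nonpos_imp_nonincreasing[where f = q and a = 0 and b = 1])
    fix t :: real assume t: "0 \<le> t" "t \<le> 1"
    have "(q has_real_derivative
            grad f (x + t *\<^sub>R v) \<bullet> v - grad f x \<bullet> v - L i * t * (rnorm m d)\<^sup>2) (at t)"
      unfolding q_def[abs_def]
      by (rule DERIV_along_line[OF diff] derivative_eq_intros refl | simp)+
    \<comment> \<open>Cauchy-Schwarz in block coordinates leaves the norm of a gradient difference;
      the block Lipschitz bound for the increment \<open>t d\<close> then supplies the factor
      \<open>t\<close>.\<close>
    moreover have "(grad f (x + t *\<^sub>R v) - grad f x) \<bullet> v \<le> L i * t * (rnorm m d)\<^sup>2"
    proof -
      have td: "(\<lambda>j. t * d j) \<in> Rvec m"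
        using d by (simp add: Rvec_def m_def V_def)
      have "(grad f (x + t *\<^sub>R v) - grad f x) \<bullet> v
              \<le> rnorm m (block_tmult V (grad f (x + t *\<^sub>R v) - grad f x)) * rnorm m d"
        unfolding v_def inner_block_mult m_def by (rule rinner_le_rnorm)
      also have "\<dots> \<le> (L i * rnorm m (\<lambda>j. t * d j)) * rnorm m d"
        using lip i td unfolding block_Lipschitz_def m_def V_def v_def
        by (intro mult_right_mono rnorm_nonneg) (metis block_mult_scale)
      also have "\<dots> = L i * t * (rnorm m d)\<^sup>2"
        using t by (simp add: rnorm_scale power2_eq_square)
      finally show ?thesis .
    qed
    ultimately show "\<exists>y. (q has_real_derivative y) (at t) \<and> y \<le> 0"
      by (intro exI conjI) (auto simp: inner_diff_left)
  qed simp
  then show ?thesis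
    by (simp add: q_def v_def inner_block_mult m_def V_def)
qed

text \<open>Minimality of \<open>d\<close> controls the model \<open>Q\<close>, and the descent
  lemma bounds f at the new point by its quadratic model with constant \<open>L i\<close>. For
  either choice of \<open>H\<close> the combination lowers F by at least \<open>\<eta> i / 2\<close>
  times the squared step length.\<close>

lemma cpg_step_decreasing:
  assumes diff: "\<And>x. f differentiable (at x)"
    and lip: "block_Lipschitz U L f" and i: "i < length U" and eta: "0 < \<eta> i"
    and step: "cpg_step f \<psi> U L \<eta> i x x'"
  shows "f x' + \<psi> x' \<le> f x + \<psi> x"
proof -
  define V where "V = U ! i"
  define m where "m = length V"
  define H where "H = (if blockwise_convex U \<psi> then (L i + \<eta> i) / 2 else L i + \<eta> i)"
  define g where "g = block_tmult V (grad f x)"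
  define Q where "Q d = f x + rinner m g d + H / 2 * (rnorm m d)\<^sup>2 + \<psi> (x + block_mult V d)" for d
  obtain d where d: "is_arg_min Q (\<lambda>d. d \<in> Rvec m) d" and x': "x' = x + block_mult V d"
    using step unfolding cpg_step_def Let_def V_def m_def H_def g_def Q_def by blast
  have dR: "d \<in> Rvec m" and min: "\<And>e. e \<in> Rvec m \<Longrightarrow> Q d \<le> Q e"
    using d by (auto simp: is_arg_min_linorder)
  have sd: "(\<lambda>j. s * d j) \<in> Rvec m" for s
    using dR by (simp add: Rvec_def)
  have upper: "f x' \<le> f x + rinner m g d + L i / 2 * (rnorm m d)\<^sup>2"
    using block_descent_lemma[OF diff lip i, of d x] dR
    by (simp add: x' g_def m_def V_def)
  define n where "n = (rnorm m d)\<^sup>2"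
  have n: "0 \<le> n" by (simp add: n_def)
  have Qs: "Q (\<lambda>j. s * d j)
      = f x + s * rinner m g d + H / 2 * (s\<^sup>2 * n) + \<psi> (x + s *\<^sub>R block_mult V d)"
    if "0 \<le> s" for s
    using that by (simp add: Q_def rinner_scale rnorm_scale block_mult_scale n_def power_mult_distrib)
  show ?thesis
  proof (cases "blockwise_convex U \<psi>")
    case False
    \<comment> \<open>Comparison with the zero step suffices here: \<open>H = L i + \<eta> i\<close>
      already exceeds the constant in the descent lemma by \<open>\<eta> i\<close>.\<close>
    have "Q d \<le> f x + \<psi> x"
      using min[OF sd[of 0]] Qs[of 0] by simp
    moreover have "0 \<le> \<eta> i * n"
      using eta n by simp
    ultimately show ?thesis
      using upper False by (simp add: Q_def H_def x' n_def field_simps)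
  next
    case True
    define a where "a = rinner m g d + \<psi> x' - \<psi> x"
    \<comment> \<open>Comparing the minimiser \<open>d\<close> with \<open>s d\<close> and letting \<open>s\<close> tend to 1 gains the full
      \<open>H n\<close> over \<open>H n / 2\<close>, which is why half the constant suffices for convex \<open>\<psi>\<close>.\<close>
    have key: "a + H / 2 * (1 + s) * n \<le> 0" if s: "0 \<le> s" "s < 1" for s
    proof -
      have "\<psi> (x + s *\<^sub>R block_mult V d) \<le> s * \<psi> x' + (1 - s) * \<psi> x"
      proof -
        have z: "(\<lambda>_. 0) \<in> Rvec m" by (simp add: Rvec_def)
        have "\<psi> (x + block_mult V (\<lambda>j. s * d j + (1 - s) * 0))
                \<le> s * \<psi> (x + block_mult V d) + (1 - s) * \<psi> (x + block_mult V (\<lambda>_. 0))"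
          using True[unfolded blockwise_convex_def, rule_format, of i d "\<lambda>_. 0" s "1 - s" x]
            i dR z s unfolding V_def m_def by simp
        moreover have "block_mult V (\<lambda>_. 0) = 0" by (simp add: block_mult_def)
        ultimately show ?thesis by (simp add: block_mult_scale x')
      qed
      moreover have "Q d \<le> Q (\<lambda>j. s * d j)" by (rule min[OF sd])
      ultimately have "Q d \<le> f x + s * rinner m g d + H / 2 * (s\<^sup>2 * n) + s * \<psi> x' + (1 - s) * \<psi> x"
        using Qs[OF s(1)] by simp
      then have "(1 - s) * (a + H / 2 * (1 + s) * n) \<le> 0"
        by (simp add: Q_def a_def x' n_def algebra_simps power2_eq_square
            add_divide_distrib diff_divide_distrib)
      then show ?thesis
        using s by (simp add: mult_le_0_iff)
    qed
    have "a + H / 2 * (1 + 1) * n \<le> 0"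
    proof (rule tendsto_upperbound)
      show "((\<lambda>s. a + H / 2 * (1 + s) * n) \<longlongrightarrow> a + H / 2 * (1 + 1) * n) (at_left 1)"
        by (intro tendsto_intros)
      show "\<forall>\<^sub>F s in at_left 1. a + H / 2 * (1 + s) * n \<le> 0"
        using eventually_at_left_real[OF zero_less_one] by eventually_elim (rule key; simp)
    qed simp
    moreover have "0 \<le> \<eta> i * n"
      using eta n by simp
    ultimately show ?thesis
      using upper True by (simp add: a_def H_def n_def field_simps)
  qed
qed

section \<open>Determinacy of CGD steps and finiteness of the set of iterates\<close>

text \<open>Testing the Lipschitz bound on the first unit vector gives a norm bounded by
  \<open>L i\<close>. This needs a coordinate, so the block must be nonempty.\<close>

lemma block_Lipschitz_nonneg:
  assumes "block_Lipschitz U L f" "i < length U" "U ! i \<noteq> []"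
  shows "0 \<le> L i"
proof -
  let ?m = "length (U ! i)"
  let ?h = "\<lambda>j::nat. if j = 0 then 1 else 0 :: real"
  have h: "?h \<in> Rvec ?m"
    using assms(3) by (auto simp: Rvec_def)
  have "(\<Sum>j<?m. (?h j)\<^sup>2) = (\<Sum>j\<in>{0}. (?h j)\<^sup>2)"
    using assms(3) by (intro sum.mono_neutral_right) auto
  then have "rnorm ?m ?h = 1"
    unfolding rnorm_def L2_set_def by simp
  then have "rnorm ?m (block_tmult (U ! i) (grad f (0 + block_mult (U ! i) ?h) - grad f 0)) \<le> L i"
    using assms(1)[unfolded block_Lipschitz_def, rule_format, OF assms(2) h, of 0]
    by (simp only: mult_1_right)
  with rnorm_nonneg show ?thesis
    by (rule order_trans)
qed

text \<open>The left-hand side is strictly increasing on the nonnegative reals, as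
  \<open>b > 0\<close>. With exponent 2, or \<open>p + 1\<close>, this covers the equations for
  \<alpha> in the first three CGD rules.\<close>

lemma power_linear_root_unique:
  fixes a b \<alpha> \<beta> :: real
  assumes "0 \<le> a" "0 < b" "0 \<le> \<alpha>" "0 \<le> \<beta>"
    and eq: "a * \<alpha> ^ n + b * \<alpha> = a * \<beta> ^ n + b * \<beta>"
  shows "\<alpha> = \<beta>"
proof -
  have less: "a * u ^ n + b * u < a * v ^ n + b * v" if "0 \<le> u" "u < v" for u v
    using that assms by (intro add_le_less_mono mult_left_mono power_mono) auto
  show ?thesis
    using less[of \<alpha> \<beta>] less[of \<beta> \<alpha>] assms by linarith
qed

lemma rule1_unique:
  assumes "0 < H\<psi>" "0 < L\<psi>" "0 < Hf" "rule1 H\<psi> L\<psi> p Hf g x HF" "rule1 H\<psi> L\<psi> p Hf g x HF'"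
  shows "HF = HF'"
proof -
  have "0 < H\<psi> / 2 * norm x ^ p + Hf"
    using assms by (intro add_nonneg_pos) auto
  note root_unique = power_linear_root_unique[OF _ this, of "L\<psi> / 6" _ _ 2]
  have "0 \<le> L\<psi> / 6"
    using assms(2) by simp
  from root_unique[OF this] assms(4,5) show ?thesis
    unfolding rule1_def by blast
qed

lemma rule2_unique:
  assumes "0 < H\<psi>" "0 < Hf" "rule2 H\<psi> p Hf g x HF" "rule2 H\<psi> p Hf g x HF'"
  shows "HF = HF'"
proof -
  have "0 < 2 ^ (p - 1) * H\<psi> * norm x ^ p + Hf" "0 \<le> 2 ^ (p - 1) * H\<psi>"
    using assms by (auto intro!: add_nonneg_pos)
  note root_unique = power_linear_root_unique[OF this(2,1), of _ _ "p + 1"]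
  from root_unique assms(3,4) show ?thesis
    unfolding rule2_def by blast
qed

lemma rule3_unique:
  assumes "0 < L\<psi>" "0 < Hf" "rule3 \<psi> L\<psi> x0 Hf g x HF" "rule3 \<psi> L\<psi> x0 Hf g x HF'"
  shows "HF = HF'"
proof -
  let ?b = "L\<psi> / 2 * norm (x - x0) + 1 / 2 * onorm ((*v) (hessian \<psi> x0)) + Hf"
  have "0 < ?b"
    using assms by (intro add_nonneg_pos add_nonneg_nonneg) (auto intro: onorm_pos_le)
  note root_unique = power_linear_root_unique[OF _ this, of "L\<psi> / 6" _ _ 2]
  have "0 \<le> L\<psi> / 6"
    using assms(1) by simp
  from root_unique[OF this] assms(3,4) show ?thesis
    unfolding rule3_def by blast
qed

lemma cgd_step_unique:
  assumes lip: "block_Lipschitz U L f" and i: "i < length U" and eta: "0 < \<eta> i"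
    and R: "\<And>Hf g HF HF'. 0 < Hf \<Longrightarrow> R Hf g x HF \<Longrightarrow> R Hf g x HF' \<Longrightarrow> HF = HF'"
    and "cgd_step R F U L \<eta> i x y" "cgd_step R F U L \<eta> i x z"
  shows "y = z"
proof (cases "U ! i = []")
  \<comment> \<open>An empty block says nothing about the sign of \<open>L i\<close>, so
    \<open>(L i + \<eta> i) / 2\<close> may fail to be positive; but then the update is an empty sum
    and both successors equal \<open>x\<close>.\<close>
  case True
  then show ?thesis
    using assms(5,6) by (auto simp: cgd_step_def Let_def block_mult_def)
next
  case False
  then have "0 < (L i + \<eta> i) / 2"
    using block_Lipschitz_nonneg[OF lip i] eta by simp
  from R[OF this] assms(5,6) show ?thesis
    unfolding cgd_step_def Let_def by blast
qed

text \<open>From a fixed start, a step determined by the current point and one of N indices reaches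
  at most N times as many points at each stage. Hence any function of the iterate is bounded at each
  fixed time.\<close>

lemma finite_range_iterates:
  fixes X :: "nat \<Rightarrow> 'w \<Rightarrow> 'a" and idx :: "nat \<Rightarrow> 'w \<Rightarrow> nat"
  assumes init: "\<And>\<omega>. \<omega> \<in> \<Omega> \<Longrightarrow> X 0 \<omega> = x0"
    and idx: "\<And>j \<omega>. \<omega> \<in> \<Omega> \<Longrightarrow> idx j \<omega> < N"
    and iterate: "\<And>j \<omega>. \<omega> \<in> \<Omega> \<Longrightarrow> step (idx j \<omega>) (X j \<omega>) (X (Suc j) \<omega>)"
    and unique: "\<And>i x y z. i < N \<Longrightarrow> step i x y \<Longrightarrow> step i x z \<Longrightarrow> y = z"
  shows "finite (X j ` \<Omega>)"
proof (induction j)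
  case 0
  have "X 0 ` \<Omega> \<subseteq> {x0}" using init by auto
  then show ?case by (rule finite_subset) simp
next
  case (Suc j)
  have "X (Suc j) ` \<Omega> \<subseteq> (\<lambda>(i, x). THE y. step i x y) ` ({..<N} \<times> X j ` \<Omega>)"
  proof clarify
    fix \<omega> assume \<omega>: "\<omega> \<in> \<Omega>"
    have "(THE y. step (idx j \<omega>) (X j \<omega>) y) = X (Suc j) \<omega>"
      using iterate[OF \<omega>] unique[OF idx[OF \<omega>]] by blast
    then show "X (Suc j) \<omega> \<in> (\<lambda>(i, x). THE y. step i x y) ` ({..<N} \<times> X j ` \<Omega>)"
      using \<omega> idx by (intro image_eqI[where x = "(idx j \<omega>, X j \<omega>)"]) auto
  qed
  then show ?case
    using Suc.IH by (meson finite_SigmaI finite_imageI finite_lessThan finite_subset)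
qed

section \<open>Telescoping of expectations and Markov's inequality\<close>

context prob_space
begin

text \<open>A conditional expectation has the same mean as the variable itself, so integrating the
  decrease leaves differences of consecutive means, which telescope.\<close>

lemma sum_expectation_le_of_expected_decrease:
  fixes Y g :: "nat \<Rightarrow> 'a \<Rightarrow> real"
  assumes sub: "\<And>j. subalgebra M (A j)"
    and Y: "\<And>j. integrable M (Y j)"
    and g: "\<And>j. g j \<in> borel_measurable M" "\<And>j \<omega>. 0 \<le> g j \<omega>"
    and C: "0 < C"
    and dec: "\<And>j. AE \<omega> in M. C * g j \<omega> \<le> Y j \<omega> - real_cond_exp M (A j) (Y (Suc j)) \<omega>"
  shows "integrable M (g j)"
    and "C * (\<Sum>j<k. expectation (g j)) \<le> expectation (Y 0) - expectation (Y k)"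
proof -
  have ce: "integrable M (real_cond_exp M (A j) (Y (Suc j)))"
    "expectation (real_cond_exp M (A j) (Y (Suc j))) = expectation (Y (Suc j))" for j
  proof -
    interpret finite_measure_subalgebra M "A j"
      by unfold_locales (rule sub)
    show "integrable M (real_cond_exp M (A j) (Y (Suc j)))"
      "expectation (real_cond_exp M (A j) (Y (Suc j))) = expectation (Y (Suc j))"
      using real_cond_exp_int[OF Y] by auto
  qed
  \<comment> \<open>Integrability of \<open>g j\<close> is a consequence of the decrease: the
    nonnegative \<open>C * g j\<close> is dominated almost everywhere by an integrable
    function.\<close>
  have int: "integrable M (\<lambda>\<omega>. C * g j \<omega>)" for j
  proof (rule Bochner_Integration.integrable_bound)
    show "integrable M (\<lambda>\<omega>. Y j \<omega> - real_cond_exp M (A j) (Y (Suc j)) \<omega>)"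
      by (intro Bochner_Integration.integrable_diff Y ce)
    show "AE \<omega> in M. norm (C * g j \<omega>) \<le> norm (Y j \<omega> - real_cond_exp M (A j) (Y (Suc j)) \<omega>)"
      using dec[of j]
    proof eventually_elim
      case (elim \<omega>)
      moreover have "0 \<le> C * g j \<omega>" using C g by simp
      ultimately show ?case by simp
    qed
  qed (use g in measurable)
  then show "integrable M (g j)" for j
    using C by simp
  show "C * (\<Sum>j<k. expectation (g j)) \<le> expectation (Y 0) - expectation (Y k)"
  proof (induction k)
    case (Suc k)
    have "C * expectation (g k) = expectation (\<lambda>\<omega>. C * g k \<omega>)" by simp
    also have "\<dots> \<le> expectation (\<lambda>\<omega>. Y k \<omega> - real_cond_exp M (A k) (Y (Suc k)) \<omega>)"
      by (intro integral_mono_AE int Bochner_Integration.integrable_diff Y ce dec)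
    also have "\<dots> = expectation (Y k) - expectation (Y (Suc k))"
      by (simp add: Y ce)
    finally show ?case
      using Suc.IH by (simp add: algebra_simps)
  qed simp
qed

text \<open>If every \<open>g j\<close> exceeds \<epsilon>, their sum is at least
  \<open>k * \<epsilon>\<close>. Markov's inequality applied to the sum at that threshold bounds the
  probability of failure by \<rho>.\<close>

lemma prob_Min_le_ge:
  fixes g :: "nat \<Rightarrow> 'a \<Rightarrow> real"
  assumes g: "\<And>j. integrable M (g j)" "\<And>j \<omega>. 0 \<le> g j \<omega>"
    and k: "1 \<le> k" and eps: "0 < \<epsilon>"
    and bound: "(\<Sum>j<k. expectation (g j)) \<le> real k * \<epsilon> * \<rho>"
  shows "1 - \<rho> \<le> prob {\<omega> \<in> space M. (MIN j\<in>{0..k-1}. g j \<omega>) \<le> \<epsilon>}"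
proof -
  have [measurable]: "g j \<in> borel_measurable M" for j
    using g by blast
  \<comment> \<open>Subtraction on naturals truncates: for \<open>k = 0\<close> the left side would
    be \<open>{0}\<close>. With \<open>k \<ge> 1\<close> the index set is also nonempty, so
    \<open>Min\<close> is a genuine minimum.\<close>
  have idxs: "{0..k-1} = {..<k}" using k by auto
  define S where "S \<omega> = (\<Sum>j<k. g j \<omega>)" for \<omega>
  have S: "integrable M S" "expectation S = (\<Sum>j<k. expectation (g j))" "\<And>\<omega>. 0 \<le> S \<omega>"
    unfolding S_def using g by (auto intro: sum_nonneg)
  have [measurable]: "S \<in> borel_measurable M" unfolding S_def by measurable
  have Min_iff: "(MIN j\<in>{0..k-1}. g j \<omega>) \<le> \<epsilon> \<longleftrightarrow> (\<exists>j<k. g j \<omega> \<le> \<epsilon>)" for \<omega>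
    unfolding idxs using k by (subst Min_le_iff) (auto simp: lessThan_empty_iff)
  have small: "\<exists>j<k. g j \<omega> \<le> \<epsilon>" if "S \<omega> < real k * \<epsilon>" for \<omega>
  proof (rule ccontr)
    assume "\<not> ?thesis"
    then have "(\<Sum>j<k. \<epsilon>) \<le> S \<omega>"
      unfolding S_def by (intro sum_mono) force
    with that show False by simp
  qed
  have ke: "0 < real k * \<epsilon>" using k eps by simp
  have "prob {\<omega> \<in> space M. real k * \<epsilon> \<le> S \<omega>} \<le> expectation S / (real k * \<epsilon>)"
    using integral_Markov_inequality_measure[OF S(1), where A = "{}" and c = "real k * \<epsilon>"] S ke
    by simp
  also have "\<dots> \<le> \<rho>"
    using bound ke by (simp add: S(2) pos_divide_le_eq mult.commute)
  finally have "1 - \<rho> \<le> 1 - prob {\<omega> \<in> space M. real k * \<epsilon> \<le> S \<omega>}" by simp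
  also have "\<dots> = prob {\<omega> \<in> space M. \<not> real k * \<epsilon> \<le> S \<omega>}"
    by (rule prob_neg[symmetric]) measurable
  also have "\<dots> \<le> prob {\<omega> \<in> space M. (MIN j\<in>{0..k-1}. g j \<omega>) \<le> \<epsilon>}"
    unfolding Min_iff using small by (intro finite_measure_mono) (auto simp: not_le)
  finally show ?thesis .
qed

end

section \<open>Integrability for both algorithms, then the probability bound\<close>

theorem theorem6p1:
  fixes f \<psi> F :: "real^'n \<Rightarrow> real"
    and U :: "(real^'n) list list"
    and L \<eta> :: "nat \<Rightarrow> real"
    and H\<psi> L\<psi> Fstar C \<epsilon> \<rho> :: real
    and p k :: nat
    and x0 :: "real^'n"
    and M :: "'w measure"
    and idx :: "nat \<Rightarrow> 'w \<Rightarrow> nat"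
    and X :: "nat \<Rightarrow> 'w \<Rightarrow> real^'n"
    and step :: "nat \<Rightarrow> real^'n \<Rightarrow> real^'n \<Rightarrow> bool"
  assumes F: "F = (\<lambda>x. f x + \<psi> x)"
    and U: "column_permutation U"
    and f_diff: "\<And>x. f differentiable (at x)"
    and A1: "block_Lipschitz U L f"
    and A2: "twice_cont_diff \<psi>"
    and A3: "\<exists>xs. F xs = Fstar \<and> (\<forall>y. F xs \<le> F y)"
    and eta: "\<And>i. i < length U \<Longrightarrow> \<eta> i > 0"
    and algorithm:
      "step = cpg_step f \<psi> U L \<eta>
       \<or> hessian_growth U H\<psi> p \<psi> \<and> hessian_Lipschitz L\<psi> \<psi> \<and>
           step = cgd_step (rule1 H\<psi> L\<psi> p) F U L \<eta>
       \<or> hessian_growth U H\<psi> p \<psi> \<and> step = cgd_step (rule2 H\<psi> p) F U L \<eta>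
       \<or> hessian_Lipschitz L\<psi> \<psi> \<and> step = cgd_step (rule3 \<psi> L\<psi> x0) F U L \<eta>
       \<or> block_linear_upper_bound U \<psi> \<and> step = cgd_step rule4 F U L \<eta>"
    and M: "prob_space M"
    and X_meas: "\<And>j. X j \<in> borel_measurable M"
    and idx: "uniform_block_choice M (length U) idx X"
    and init: "\<And>\<omega>. \<omega> \<in> space M \<Longrightarrow> X 0 \<omega> = x0"
    and iterate: "\<And>j \<omega>. \<omega> \<in> space M \<Longrightarrow> step (idx j \<omega>) (X j \<omega>) (X (Suc j) \<omega>)"
    and C: "C > 0"
    and descent:
      "\<And>j. AE \<omega> in M.
         F (X j \<omega>)
           - real_cond_exp M (vimage_algebra (space M) (X j) borel) (\<lambda>\<omega>'. F (X (Suc j) \<omega>')) \<omega>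
         \<ge> C * (norm (grad F (X j \<omega>)))\<^sup>2"
    and eps: "\<epsilon> > 0"
    and rho: "0 < \<rho>" "\<rho> < 1"
    and k: "k \<ge> 1" "real k \<ge> (F x0 - Fstar) / (\<epsilon> * \<rho> * C)"
  shows "\<P>(\<omega> in M. (MIN j\<in>{0..k-1}. (norm (grad F (X j \<omega>)))\<^sup>2) \<le> \<epsilon>) \<ge> 1 - \<rho>"
proof -
  interpret prob_space M by (rule M)
  \<comment> \<open>\<open>indep_vars\<close> includes measurability of \<open>idx j\<close> into
    \<open>count_space {..<length U}\<close>, so the index is in range at every sample point and not
    only almost surely.\<close>
  have idx_less: "idx j \<omega> < length U" if "\<omega> \<in> space M" for j \<omega>
    using idx that unfolding uniform_block_choice_def indep_vars_def
    by (auto dest!: measurable_space)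
  have F_diff: "F differentiable (at x)" for x
    using f_diff A2 by (auto simp: F twice_cont_diff_def)
  then have "continuous_on UNIV F"
    by (intro differentiable_imp_continuous_on) (simp add: differentiable_on_def)
  then have [measurable]: "F \<in> borel_measurable borel"
    by (rule borel_measurable_continuous_onI)
  note [measurable] = X_meas grad_measurable[of F, OF F_diff]
  have lower: "Fstar \<le> F x" for x
    using A3 by auto
  \<comment> \<open>F is bounded below by \<open>Fstar\<close>; an upper bound, possibly depending
    on \<open>j\<close>, makes \<open>F (X j)\<close> integrable, as the averaging of conditional
    expectations requires.\<close>
  have upper: "\<exists>B. \<forall>\<omega>\<in>space M. F (X j \<omega>) \<le> B" for j
  proof (cases "step = cpg_step f \<psi> U L \<eta>")
    case True
    have "F (X j \<omega>) \<le> F x0" if \<omega>: "\<omega> \<in> space M" for \<omega>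
    proof (induction j)
      case (Suc j)
      have "F (X (Suc j) \<omega>) \<le> F (X j \<omega>)"
        unfolding F using True iterate[OF \<omega>, of j] idx_less[OF \<omega>, of j] eta
        by (intro cpg_step_decreasing[OF f_diff A1]) auto
      with Suc.IH show ?case by simp
    qed (simp add: init \<omega>)
    then show ?thesis by auto
  next
    case False
    have unique: "y = z" if i: "i < length U" and st: "step i x y" "step i x z" for i x y z
    proof -
      have *: "step = cgd_step R F U L \<eta> \<Longrightarrow>
          (\<And>Hf g HF HF'. 0 < Hf \<Longrightarrow> R Hf g x HF \<Longrightarrow> R Hf g x HF' \<Longrightarrow> HF = HF') \<Longrightarrow> y = z" for R
        using cgd_step_unique[OF A1 i, of \<eta> R x F y z] eta[OF i] st by blast
      \<comment> \<open>In the first three rules a unique root \<alpha> fixes \<open>HF\<close>; the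
        fourth prescribes \<open>HF\<close> outright.\<close>
      from algorithm False show ?thesis
        unfolding hessian_growth_def hessian_Lipschitz_def
        by (elim disjE conjE)
          (auto elim!: * dest: rule1_unique[rotated 3] rule2_unique[rotated 2]
             rule3_unique[rotated 2] simp: rule4_def)
    qed
    have "finite (X j ` space M)"
      using init idx_less iterate unique by (rule finite_range_iterates)
    then have "bdd_above (F ` X j ` space M)"
      by (intro bdd_above_finite finite_imageI[where h = F])
    then show ?thesis by (auto simp: bdd_above_def)
  qed
  have int: "integrable M (\<lambda>\<omega>. F (X j \<omega>))" for j
  proof -
    obtain B where B: "\<And>\<omega>. \<omega> \<in> space M \<Longrightarrow> F (X j \<omega>) \<le> B"
      using upper by blast
    have "\<bar>F (X j \<omega>)\<bar> \<le> \<bar>B\<bar> + \<bar>Fstar\<bar>" if "\<omega> \<in> space M" for \<omega>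
      using B[OF that] lower[of "X j \<omega>"] by linarith
    then show ?thesis
      by (intro integrable_const_bound[of _ "\<bar>B\<bar> + \<bar>Fstar\<bar>"] AE_I2) auto
  qed
  \<comment> \<open>Conditioning is on \<open>X j\<close> alone, and measurability of
    \<open>X j\<close> places its generated sigma-algebra inside that of \<open>M\<close>.\<close>
  have sub: "subalgebra M (vimage_algebra (space M) (X j) borel)" for j
    unfolding subalgebra_def
    by (auto simp: sets_vimage_algebra2 intro: measurable_sets[OF X_meas])
  define g where "g j \<omega> = (norm (grad F (X j \<omega>)))\<^sup>2" for j \<omega>
  have g_meas: "g j \<in> borel_measurable M" for j
    unfolding g_def by measurable
  have g_nonneg: "0 \<le> g j \<omega>" for j \<omega>
    by (simp add: g_def)
  note tele = sum_expectation_le_of_expected_decrease[where g = g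
      and Y = "\<lambda>j \<omega>. F (X j \<omega>)" and A = "\<lambda>j. vimage_algebra (space M) (X j) borel",
      OF sub int g_meas g_nonneg C descent[folded g_def]]
  have "C * (\<Sum>j<k. expectation (g j))
          \<le> expectation (\<lambda>\<omega>. F (X 0 \<omega>)) - expectation (\<lambda>\<omega>. F (X k \<omega>))"
    by (rule tele)
  also have "expectation (\<lambda>\<omega>. F (X 0 \<omega>)) = F x0"
    by (simp add: init prob_space cong: Bochner_Integration.integral_cong)
  also have "F x0 - expectation (\<lambda>\<omega>. F (X k \<omega>)) \<le> F x0 - Fstar"
    using integral_ge_const[OF int, of Fstar k] lower by simp
  finally have "C * (\<Sum>j<k. expectation (g j)) \<le> F x0 - Fstar" .
  \<comment> \<open>This is the lower bound on \<open>k\<close> with its positive denominator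
    cleared; cancelling \<open>C\<close> gives the budget required for Markov's inequality.\<close>
  also have "\<dots> \<le> C * (real k * \<epsilon> * \<rho>)"
    using k(2) C eps rho by (simp add: pos_divide_le_eq algebra_simps)
  finally have "(\<Sum>j<k. expectation (g j)) \<le> real k * \<epsilon> * \<rho>"
    using C by simp
  from prob_Min_le_ge[OF tele(1) g_nonneg k(1) eps this]
  show ?thesis by (simp add: g_def)
qed


end
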